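(* Let $\mathbf{X}$ denote a random element of the type space $\mathcal{S}$ distributed according to $\mu$. Suppose that $\mu$ is such that $(\lambda_+(\mathbf{X}),\lambda_-(\mathbf{X}))$ is non-standard regularly varying with scaling functions $a(t)\in\mathcal{R}_{1/\alpha}$ and $b(t)\in\mathcal{R}_{1/\beta}$ (for some $\alpha,\beta>0$) and limiting measure $\nu(\cdot)$. Then $(Z^+,Z^-)$ is non-standard regularly varying with scaling functions $a(t)$ and $b(t)$ and limiting measure $\nu(\cdot)$ as well.
   Context: $\mathcal{S}$ is a separable metric space, $\mu$ a Borel probability measure on $\mathcal{S}$, and $\kappa:\mathcal{S}\times\mathcal{S}\to[0,\infty)$ a kernel that is continuous $\mu\times\mu$-a.e. and satisfies $\iint_{\mathcal{S}^2}\kappa(\mathbf{x},\mathbf{y})\mu(d\mathbf{x})\mu(d\mathbf{y})<\infty$. Define $$\lambda_+(\mathbf{x})=\int_{\mathcal{S}}\kappa(\mathbf{y},\mathbf{x})\,\mu(d\mathbf{y}),\qquad \lambda_-(\mathbf{x})=\int_{\mathcal{S}}\kappa(\mathbf{x},\mathbf{y})\,\mu(d\mathbf{y}).$$ $Z^+$ and $Z^-$ are random variables which, conditionally on $\mathbf{X}$, are independent and Poisson distributed with means $\lambda_+(\mathbf{X})$ and $\lambda_-(\mathbf{X})$, respectively. Definition. A nonnegative random vector $(X,Y)\in\mathbb{R}^2$ has a distribution that is non-standard regularly varying if there exist scaling functions $a(t)\uparrow\infty$ and $b(t)\uparrow\infty$ and a non-zero limit measure $\nu(\cdot)$, called the limit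 or tail measure, such that $$tP\left((X/a(t),Y/b(t))\in\cdot\right)\xrightarrow{v}\nu(\cdot),\qquad t\to\infty,$$ where $\xrightarrow{v}$ denotes vague convergence of measures in $M_+([0,\infty]^2\setminus\{\mathbf{0}\})$, the space of Radon measures on $[0,\infty]^2\setminus\{\mathbf{0}\}$. $\mathcal{R}_{\gamma}$ denotes the family of functions regularly varying at infinity with index $\gamma$. *)

theory Defs
  imports "HOL-Probability.Probability"
begin

subsection \<open>Regular variation and vague convergence\<close>

definition regularly_varying :: "real \<Rightarrow> (real \<Rightarrow> real) set" where
  "regularly_varying \<gamma> = {f. \<exists>T>0.
     f \<in> borel_measurable (restrict_space borel {T..}) \<and>
     (\<forall>t\<ge>T. f t > 0) \<and>
     (\<forall>c>0. ((\<lambda>t. f (c * t) / f t) \<longlongrightarrow> c powr \<gamma>) at_top)}"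

definition scaling_function :: "(real \<Rightarrow> real) \<Rightarrow> bool" where
  "scaling_function a \<longleftrightarrow> mono_on {0<..} a \<and> filterlim a at_top at_top"

text \<open>
  Finiteness on compact sets characterises Radon measures among the Borel measures on \<open>E\<close> when
  \<open>E\<close> is a locally compact Hausdorff space with a countable base, which is the only case used
  below. A subset of \<open>E\<close> is compact in the subspace topology iff it is compact.
\<close>
definition radon_on :: "'a::topological_space set \<Rightarrow> 'a measure \<Rightarrow> bool" where
  "radon_on E N \<longleftrightarrow>
     sets N = sets (restrict_space borel E) \<and>
     (\<forall>K. compact K \<and> K \<subseteq> E \<longrightarrow> emeasure N K < \<infinity>)"

definition CK_plus :: "'a::topological_space set \<Rightarrow> ('a \<Rightarrow> real) set" where
  "CK_plus E = {f. continuous_on E f \<and> (\<forall>x\<in>E. 0 \<le> f x) \<and>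
     (\<exists>K. compact K \<and> K \<subseteq> E \<and> (\<forall>x\<in>E - K. f x = 0))}"

definition vaguely_tendsto ::
  "'a::topological_space set \<Rightarrow> ('i \<Rightarrow> 'a measure) \<Rightarrow> 'a measure \<Rightarrow> 'i filter \<Rightarrow> bool" where
  "vaguely_tendsto E N L F \<longleftrightarrow>
     (\<forall>\<^sub>F t in F. radon_on E (N t)) \<and> radon_on E L \<and>
     (\<forall>f\<in>CK_plus E. ((\<lambda>t. \<integral>\<^sup>+ x. ennreal (f x) \<partial>N t) \<longlongrightarrow> (\<integral>\<^sup>+ x. ennreal (f x) \<partial>L)) F)"

subsection \<open>Non-standard regular variation\<close>

text \<open>The type \<^typ>\<open>ennreal\<close> is the compactified half-line \<open>[0, \<infinity>]\<close>.\<close>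

definition punctured_quadrant :: "(ennreal \<times> ennreal) set" where
  "punctured_quadrant = - {(0, 0)}"

text \<open>
  The measure \<open>t P((X/a(t), Y/b(t)) \<in> \<cdot>)\<close> on the punctured quadrant. The embedding
  \<^const>\<open>ennreal\<close> truncates negative reals to 0, which plays no role once
  \<open>X, Y \<ge> 0\<close> and \<open>a(t), b(t) > 0\<close>.
\<close>
definition scaled_law ::
  "'w measure \<Rightarrow> ('w \<Rightarrow> real) \<Rightarrow> ('w \<Rightarrow> real) \<Rightarrow> (real \<Rightarrow> real) \<Rightarrow> (real \<Rightarrow> real) \<Rightarrow> real
     \<Rightarrow> (ennreal \<times> ennreal) measure" where
  "scaled_law M X Y a b t =
     scale_measure (ennreal t)
       (restrict_space
         (distr M borel (\<lambda>\<omega>. (ennreal (X \<omega> / a t), ennreal (Y \<omega> / b t))))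
         punctured_quadrant)"

definition nonstandard_regularly_varying ::
  "'w measure \<Rightarrow> ('w \<Rightarrow> real) \<Rightarrow> ('w \<Rightarrow> real) \<Rightarrow> (real \<Rightarrow> real) \<Rightarrow> (real \<Rightarrow> real)
     \<Rightarrow> (ennreal \<times> ennreal) measure \<Rightarrow> bool" where
  "nonstandard_regularly_varying M X Y a b \<nu> \<longleftrightarrow>
     X \<in> borel_measurable M \<and> Y \<in> borel_measurable M \<and>
     (\<forall>\<omega>\<in>space M. 0 \<le> X \<omega> \<and> 0 \<le> Y \<omega>) \<and>
     scaling_function a \<and> scaling_function b \<and>
     emeasure \<nu> punctured_quadrant \<noteq> 0 \<and>
     vaguely_tendsto punctured_quadrant (scaled_law M X Y a b) \<nu> at_top"

subsection \<open>The kernel and the mixed Poisson variables\<close>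

text \<open>
  The integrals are real-valued. When \<open>\<kappa>\<close> is integrable with respect to \<open>\<mu> \<otimes> \<mu>\<close> they converge
  for \<open>\<mu>\<close>-almost every \<open>x\<close>; on the remaining null set they take the value 0 instead of \<open>\<infinity>\<close>.
\<close>
definition lambda_plus :: "'s measure \<Rightarrow> ('s \<Rightarrow> 's \<Rightarrow> real) \<Rightarrow> 's \<Rightarrow> real" where
  "lambda_plus \<mu> \<kappa> x = (\<integral>y. \<kappa> y x \<partial>\<mu>)"

definition lambda_minus :: "'s measure \<Rightarrow> ('s \<Rightarrow> 's \<Rightarrow> real) \<Rightarrow> 's \<Rightarrow> real" where
  "lambda_minus \<mu> \<kappa> x = (\<integral>y. \<kappa> x y \<partial>\<mu>)"

text \<open>The conditional probability \<open>P(A | X)\<close>, for a Borel random element \<open>X\<close>.\<close>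

definition cond_prob_given ::
  "'w measure \<Rightarrow> ('w \<Rightarrow> 's::topological_space) \<Rightarrow> 'w set \<Rightarrow> 'w \<Rightarrow> real" where
  "cond_prob_given M X A =
     real_cond_exp M (vimage_algebra (space M) X borel) (indicator A)"

text \<open>\<^const>\<open>poisson_pmf\<close> is only specified for positive rates; rate 0 is the point mass at 0.\<close>

definition poisson_law :: "real \<Rightarrow> nat pmf" where
  "poisson_law r = (if r = 0 then return_pmf 0 else poisson_pmf r)"

definition cond_poisson ::
  "'w measure \<Rightarrow> ('w \<Rightarrow> 's::topological_space) \<Rightarrow> ('w \<Rightarrow> nat) \<Rightarrow> ('s \<Rightarrow> real) \<Rightarrow> bool" where
  "cond_poisson M X Z l \<longleftrightarrow>
     (\<forall>k. AE \<omega> in M.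
        cond_prob_given M X {w \<in> space M. Z w = k} \<omega> = pmf (poisson_law (l (X \<omega>))) k)"

definition cond_indep ::
  "'w measure \<Rightarrow> ('w \<Rightarrow> 's::topological_space) \<Rightarrow> ('w \<Rightarrow> nat) \<Rightarrow> ('w \<Rightarrow> nat) \<Rightarrow> bool" where
  "cond_indep M X Y Z \<longleftrightarrow>
     (\<forall>A B. AE \<omega> in M.
        cond_prob_given M X {w \<in> space M. Y w \<in> A \<and> Z w \<in> B} \<omega> =
        cond_prob_given M X {w \<in> space M. Y w \<in> A} \<omega> *
        cond_prob_given M X {w \<in> space M. Z w \<in> B} \<omega>)"

end

theory Submission
  imports Defs "HOL-Real_Asymp.Real_Asymp"
begin

text \<open>
  A Poisson variable with a large mean is close to its mean on a relative scale, and one with a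
  small mean is small up to an exponentially unlikely event. So replacing the means
  \<open>(\<lambda>\<^sub>+, \<lambda>\<^sub>-)\<close> by the counts \<open>(Z\<^sup>+, Z\<^sup>-)\<close> does not change what is seen at the scale \<open>(a t, b t)\<close>
  by a test function supported away from the origin.

  A test function \<open>f\<close> extends by zero to a continuous function on the compact square
  \<open>[0, \<infinity>]\<^sup>2\<close>. In the coordinate \<open>1 / (1 + x)\<close> it becomes uniformly continuous, so \<open>f\<close>
  hardly changes when \<open>x\<close> moves by less than \<open>h (1 + x)\<close>, with \<open>h\<close> independent of \<open>x\<close>
  (\<open>relative_uniform_continuity\<close>). Let \<open>A t\<close> be the event that one of the scaled means exceeds
  a small constant. Vague convergence bounds \<open>t P(A t)\<close> (\<open>exceedance_bounded\<close>), and on \<open>A t\<close>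
  Chebyshev's inequality makes the conditional probability of a relative deviation of
  size \<open>h\<close> at most \<open>1 / (h\<^sup>2 a t)\<close>, uniformly in the mean
  (\<open>poisson_relative_deviation_negligible\<close>). Off \<open>A t\<close> the function vanishes at the scaled
  means, and it can differ from zero at the scaled counts only if some count exceeds twice a level
  proportional to \<open>a t\<close> (or \<open>b t\<close>) that its mean does not reach. That has conditional probability
  at most \<open>exp (- c a t)\<close> for some \<open>c > 0\<close>, and the factor \<open>t\<close> is harmless because regular
  variation with a positive index forces \<open>a t\<close> to grow at least like a power of \<open>t\<close>
  (\<open>poisson_jump_negligible\<close>). That these two negligibility statements force
  the vague limits to agree holds for arbitrary nonnegative random vectors and is
  \<open>vaguely_tendsto_perturb\<close>.

  Each count is compared with its own mean and the probabilities of the exceptional events are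
  added up. The bounds for a Poisson variable with a fixed mean pass to the counts by
  integration over the conditional law (\<open>emeasure_cond_poisson\<close>).
\<close>

section \<open>Test functions on the punctured quadrant\<close>

text \<open>
  The inverse of the homeomorphism \<open>x \<mapsto> 1 / (1 + x)\<close> from \<open>[0, \<infinity>]\<close> onto \<open>[0, 1]\<close>. Truncation at
  both ends, through \<open>ennreal u = 0\<close> for \<open>u < 0\<close> and truncated subtraction for \<open>u > 1\<close>, extends it
  to a continuous function on all reals.
\<close>
definition inv_compactify :: "real \<Rightarrow> ennreal" where
  "inv_compactify u = inverse (ennreal u) - 1"

lemma continuous_on_diff_ennreal_finite:
  fixes f :: "'a::topological_space \<Rightarrow> ennreal"
  assumes "continuous_on A f" "c \<noteq> \<infinity>"
  shows "continuous_on A (\<lambda>x. f x - c)"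
  using assms unfolding continuous_on_def by (auto intro!: tendsto_diff_ennreal_general)

lemma continuous_on_inv_compactify: "continuous_on UNIV inv_compactify"
  unfolding inv_compactify_def
  by (intro continuous_on_diff_ennreal_finite continuous_intros continuous_on_ennreal) auto

lemma inv_compactify_inverse: "0 \<le> x \<Longrightarrow> inv_compactify (1 / (1 + x)) = ennreal x"
proof -
  assume "0 \<le> x"
  then have "inverse (ennreal (1 / (1 + x))) = ennreal (1 + x)"
    by (subst inverse_ennreal) (auto simp: field_simps)
  then show ?thesis
    using \<open>0 \<le> x\<close> unfolding inv_compactify_def by (simp add: ennreal_minus flip: ennreal_1)
qed

lemma compact_UNIV_quadrant: "compact (UNIV :: (ennreal \<times> ennreal) set)"
  using compact_Times[OF compact_UNIV[where 'a=ennreal] compact_UNIV[where 'a=ennreal]] by simp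

definition extend_zero :: "(ennreal \<times> ennreal \<Rightarrow> real) \<Rightarrow> ennreal \<times> ennreal \<Rightarrow> real" where
  "extend_zero f p = (if p = (0, 0) then 0 else f p)"

text \<open>
  The set where a test function may be nonzero lies in a compact set that misses the origin, hence
  misses a whole box around it. This makes the extension by zero continuous at the origin.
\<close>
lemma extend_zero_CK_plus:
  assumes "f \<in> CK_plus punctured_quadrant"
  shows "continuous_on UNIV (extend_zero f)"
    and "\<exists>d>0. \<forall>x y. x < ennreal d \<longrightarrow> y < ennreal d \<longrightarrow> extend_zero f (x, y) = 0"
    and "0 \<le> extend_zero f p"
proof -
  from assms obtain K where cont: "continuous_on punctured_quadrant f"
    and nn: "\<And>x. x \<in> punctured_quadrant \<Longrightarrow> 0 \<le> f x"
    and K: "compact K" "K \<subseteq> punctured_quadrant" "\<And>x. x \<in> punctured_quadrant - K \<Longrightarrow> f x = 0"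
    unfolding CK_plus_def by auto
  have z: "extend_zero f p = 0" if "p \<notin> K" for p
    using K(3)[of p] that by (auto simp: extend_zero_def punctured_quadrant_def)
  show "0 \<le> extend_zero f p"
    using nn[of p] by (auto simp: extend_zero_def punctured_quadrant_def)
  have "open (- K)" using compact_imp_closed[OF K(1)] by auto
  have "open punctured_quadrant" by (auto simp: punctured_quadrant_def)
  have "continuous_on (punctured_quadrant \<union> - K) (extend_zero f)"
  proof (rule continuous_on_open_Un)
    show "continuous_on punctured_quadrant (extend_zero f)"
      by (rule continuous_on_eq[OF cont]) (auto simp: extend_zero_def punctured_quadrant_def)
    show "continuous_on (- K) (extend_zero f)"
      by (rule continuous_on_eq[OF continuous_on_const[of _ 0]]) (auto simp: z)
  qed fact+
  moreover have "punctured_quadrant \<union> - K = UNIV" using K(2) by auto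
  ultimately show "continuous_on UNIV (extend_zero f)" by simp
  have "(0, 0) \<in> - K" using K(2) by (auto simp: punctured_quadrant_def)
  then obtain A B where AB: "open A" "open B" "(0, 0) \<in> A \<times> B" "A \<times> B \<subseteq> - K"
    using open_prod_elim[OF \<open>open (- K)\<close>] by metis
  have *: "\<exists>d>0. {..<ennreal d} \<subseteq> A" if "open A" "0 \<in> A" for A :: "ennreal set"
  proof -
    have "\<exists>b>0. {0..<b} \<subseteq> A"
      by (rule open_right[OF that, of 1]) simp
    then obtain b where b: "b > 0" "{0..<b} \<subseteq> A" by blast
    obtain d where "0 < d" "ennreal d < b"
      using b(1) by (metis ennreal_less_zero_iff dense ennreal_cases less_top_ennreal not_less_iff_gr_or_eq order_less_trans top_greatest leD)
    then show ?thesis using b(2) by (intro exI[of _ d]) (auto simp: subset_eq)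
  qed
  obtain d1 d2 where d: "d1 > 0" "d2 > 0" "{..<ennreal d1} \<subseteq> A" "{..<ennreal d2} \<subseteq> B"
    using *[of A] *[of B] AB by auto
  have "ennreal (min d1 d2) \<le> ennreal d1" "ennreal (min d1 d2) \<le> ennreal d2"
    by (auto intro: ennreal_leI)
  then have "extend_zero f (x, y) = 0" if "x < ennreal (min d1 d2)" "y < ennreal (min d1 d2)" for x y
    using that d(3,4) AB(4) by (intro z) (force simp: subset_eq)
  then show "\<exists>d>0. \<forall>x y. x < ennreal d \<longrightarrow> y < ennreal d \<longrightarrow> extend_zero f (x, y) = 0"
    using d(1,2) by (intro exI[of _ "min d1 d2"]) auto
qed

text \<open>
  After the change of coordinate \<open>x \<mapsto> 1 / (1 + x)\<close> this is uniform continuity on the compact square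
  \<open>[0, 1]\<^sup>2\<close>, because \<open>\<bar>1 / (1 + z) - 1 / (1 + x)\<bar> \<le> \<bar>z - x\<bar> / (1 + x)\<close>. The tolerance
  \<open>h (1 + x)\<close> grows with \<open>x\<close>, and this is what Chebyshev's inequality for a Poisson variable
  can deliver uniformly in the mean.
\<close>
lemma relative_uniform_continuity:
  assumes cont: "continuous_on UNIV (g :: ennreal \<times> ennreal \<Rightarrow> real)" and "0 < e"
  shows "\<exists>h>0. \<forall>x y z w. 0 \<le> x \<longrightarrow> 0 \<le> y \<longrightarrow> 0 \<le> z \<longrightarrow> 0 \<le> w \<longrightarrow>
    \<bar>z - x\<bar> < h * (1 + x) \<longrightarrow> \<bar>w - y\<bar> < h * (1 + y) \<longrightarrow>
    \<bar>g (ennreal z, ennreal w) - g (ennreal x, ennreal y)\<bar> < e"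
proof -
  define G where "G = (\<lambda>p. g (inv_compactify (fst p), inv_compactify (snd p)))"
  have "continuous_on UNIV G"
    unfolding G_def
    by (intro continuous_on_compose2[OF cont] continuous_on_Pair
        continuous_on_compose2[OF continuous_on_inv_compactify] continuous_intros) auto
  then have "uniformly_continuous_on ({0..1} \<times> {0..1}) G"
    by (intro compact_uniformly_continuous compact_Times) (auto intro: continuous_on_subset)
  then obtain h where h: "h > 0"
    "\<And>p q. p \<in> {0..1} \<times> {0..1} \<Longrightarrow> q \<in> {0..1} \<times> {0..1} \<Longrightarrow> dist q p < h \<Longrightarrow> dist (G q) (G p) < e"
    using \<open>0 < e\<close> unfolding uniformly_continuous_on_def by metis
  have close: "\<bar>1 / (1 + z) - 1 / (1 + x)\<bar> < h / 2"
    if "0 \<le> x" "0 \<le> z" "\<bar>z - x\<bar> < h / 2 * (1 + x)" for x z :: real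
  proof -
    have "\<bar>1 / (1 + z) - 1 / (1 + x)\<bar> = \<bar>z - x\<bar> / ((1 + z) * (1 + x))"
      using that by (simp add: diff_frac_eq abs_minus_commute abs_mult)
    also have "\<dots> \<le> \<bar>z - x\<bar> / (1 + x)"
      using that by (intro divide_left_mono) (auto intro: mult_right_mono[of 1 "1 + z" "1 + x", simplified])
    also have "\<dots> < h / 2" using that by (simp add: field_simps)
    finally show ?thesis .
  qed
  show ?thesis
  proof (intro exI[of _ "h / 2"] conjI allI impI)
    fix x y z w :: real
    assume H: "0 \<le> x" "0 \<le> y" "0 \<le> z" "0 \<le> w" "\<bar>z - x\<bar> < h / 2 * (1 + x)" "\<bar>w - y\<bar> < h / 2 * (1 + y)"
    define p q where "p = (1 / (1 + x), 1 / (1 + y))" and "q = (1 / (1 + z), 1 / (1 + w))"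
    have "dist q p \<le> \<bar>1 / (1 + z) - 1 / (1 + x)\<bar> + \<bar>1 / (1 + w) - 1 / (1 + y)\<bar>"
      unfolding p_def q_def dist_Pair_Pair dist_real_def
      by (rule order_trans[OF sqrt_sum_squares_le_sum_abs]) simp
    also have "\<dots> < h" using close[of x z] close[of y w] H by simp
    finally have "dist (G q) (G p) < e"
      using H by (intro h) (auto simp: p_def q_def)
    then show "\<bar>g (ennreal z, ennreal w) - g (ennreal x, ennreal y)\<bar> < e"
      using H by (simp add: G_def p_def q_def inv_compactify_inverse dist_real_def)
  qed (use h in auto)
qed

text \<open>
  A test function that is bounded below outside the box of side \<open>2 c\<close>. Capping each summand at
  \<open>c\<close> keeps it finite at infinity.
\<close>
definition bump :: "real \<Rightarrow> ennreal \<times> ennreal \<Rightarrow> real" where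
  "bump c p = enn2real (min (ennreal c) (fst p - ennreal c) + min (ennreal c) (snd p - ennreal c))"

lemma bump_in_CK_plus:
  assumes "c > 0"
  shows "bump c \<in> CK_plus punctured_quadrant"
proof -
  let ?g = "\<lambda>p::ennreal \<times> ennreal. min (ennreal c) (fst p - ennreal c) + min (ennreal c) (snd p - ennreal c)"
  have "continuous_on UNIV ?g"
    by (intro continuous_on_add_ennreal continuous_on_min continuous_on_diff_ennreal_finite continuous_intros) auto
  moreover have fin: "?g p \<noteq> \<infinity>" for p
    by (auto simp: min_def top_unique)
  ultimately have cont: "continuous_on UNIV (bump c)"
    unfolding continuous_on_def bump_def
    by (auto intro!: tendsto_enn2real simp: less_top)
  let ?K = "{p. ennreal c \<le> fst p} \<union> {p. ennreal c \<le> snd p} :: (ennreal \<times> ennreal) set"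
  have "closed ?K"
    by (intro closed_Un closed_Collect_le continuous_intros)
  then have "compact ?K"
    using compact_Int_closed[OF compact_UNIV_quadrant, of ?K] by simp
  moreover have "?K \<subseteq> punctured_quadrant"
    using assms by (auto simp: punctured_quadrant_def)
  moreover have "bump c p = 0" if "p \<notin> ?K" for p
  proof -
    have "x - ennreal c = 0" if "x < ennreal c" for x
      using that by (cases x) (auto simp: ennreal_minus ennreal_less_iff ennreal_neg)
    with that show ?thesis by (simp add: bump_def not_le)
  qed
  ultimately show ?thesis
    using cont unfolding CK_plus_def
    by (auto simp: bump_def intro: continuous_on_subset intro!: exI[of _ ?K])
qed

lemma bump_lower:
  assumes "c > 0" "ennreal (2 * c) \<le> fst p \<or> ennreal (2 * c) \<le> snd p"
  shows "c \<le> bump c p"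
proof -
  have *: "min (ennreal c) (x - ennreal c) = ennreal c" if "ennreal (2 * c) \<le> x" for x
  proof -
    have "ennreal c = ennreal (2 * c) - ennreal c" using assms(1) by (simp add: ennreal_minus)
    also have "\<dots> \<le> x - ennreal c" using that by (rule ennreal_minus_mono) simp
    finally show ?thesis by (simp add: min_def)
  qed
  have fin: "min (ennreal c) (x - ennreal c) \<le> ennreal c" for x by simp
  let ?g = "min (ennreal c) (fst p - ennreal c) + min (ennreal c) (snd p - ennreal c)"
  have "ennreal c \<le> ?g"
    using assms(2) *[of "fst p"] *[of "snd p"] by auto
  moreover have "?g < \<infinity>"
    using fin[of "fst p"] fin[of "snd p"] by (auto simp: less_top[symmetric] min_def top_unique)
  ultimately have "enn2real (ennreal c) \<le> enn2real ?g"
    by (intro enn2real_mono) auto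
  then show ?thesis using assms(1) by (simp add: bump_def)
qed

section \<open>Scaled laws and their vague limits\<close>

text \<open>
  A test function is bounded and vanishes off a compact set, which has finite measure.
\<close>
lemma CK_plus_nn_integral_finite:
  fixes E :: "'a::t2_space set"
  assumes "radon_on E N" and "f \<in> CK_plus E"
  shows "(\<integral>\<^sup>+ x. ennreal (f x) \<partial>N) < \<infinity>"
proof -
  from assms(2) obtain K where cont: "continuous_on E f"
    and K: "compact K" "K \<subseteq> E" "\<And>x. x \<in> E - K \<Longrightarrow> f x = 0"
    unfolding CK_plus_def by auto
  have sets: "sets N = sets (restrict_space borel E)" and fin: "emeasure N K < \<infinity>"
    using assms(1) K unfolding radon_on_def by auto
  have space: "space N = E"
    using sets_eq_imp_space_eq[OF sets] by (simp add: space_restrict_space)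
  have "K \<in> sets N"
    unfolding sets sets_restrict_space using K compact_imp_closed[OF K(1)] by (auto intro!: image_eqI[of _ _ K])
  have "compact (f ` K)"
    using K cont by (intro compact_continuous_image) (auto intro: continuous_on_subset)
  then have "bounded (f ` K)" by (rule compact_imp_bounded)
  then obtain B where B: "\<And>x. x \<in> K \<Longrightarrow> norm (f x) \<le> B"
    by (auto simp: bounded_iff)
  have "(\<integral>\<^sup>+ x. ennreal (f x) \<partial>N) \<le> (\<integral>\<^sup>+ x. ennreal B * indicator K x \<partial>N)"
  proof (rule nn_integral_mono)
    fix x assume x: "x \<in> space N"
    show "ennreal (f x) \<le> ennreal B * indicator K x"
    proof (cases "x \<in> K")
      case True
      have "f x \<le> B" using B[OF True] by simp
      then have "ennreal (f x) \<le> ennreal B" by (rule ennreal_leI)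
      then show ?thesis using True by simp
    next
      case False
      then have "f x = 0" using x by (intro K(3)) (simp add: space)
      then show ?thesis by simp
    qed
  qed
  also have "\<dots> = ennreal B * emeasure N K"
    using \<open>K \<in> sets N\<close> by (rule nn_integral_cmult_indicator)
  also have "\<dots> < \<infinity>"
    using fin by (simp add: ennreal_mult_less_top)
  finally show ?thesis .
qed

lemma measurable_scaled_pair [measurable]:
  assumes [measurable]: "X \<in> borel_measurable M" "Y \<in> borel_measurable M"
  shows "(\<lambda>\<omega>. (ennreal (X \<omega> / r), ennreal (Y \<omega> / s))) \<in> borel_measurable M"
  by (intro borel_measurable_Pair) measurable

lemma sets_punctured_quadrant: "punctured_quadrant \<in> sets borel"
  by (auto simp: punctured_quadrant_def)

lemma radon_on_scaled_law:
  assumes "prob_space M" and "X \<in> borel_measurable M" "Y \<in> borel_measurable M"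
  shows "radon_on punctured_quadrant (scaled_law M X Y a b t)"
proof -
  let ?h = "\<lambda>\<omega>. (ennreal (X \<omega> / a t), ennreal (Y \<omega> / b t))"
  interpret D: prob_space "distr M borel ?h"
    using assms by (intro prob_space.prob_space_distr measurable_scaled_pair)
  have "emeasure (scaled_law M X Y a b t) K < \<infinity>" if "K \<subseteq> punctured_quadrant" for K
  proof -
    have "emeasure (scaled_law M X Y a b t) K = ennreal t * emeasure (distr M borel ?h) K"
      using that sets_punctured_quadrant by (simp add: scaled_law_def emeasure_restrict_space)
    also have "\<dots> < \<infinity>"
      by (simp add: D.emeasure_eq_measure ennreal_mult_less_top)
    finally show ?thesis .
  qed
  then show ?thesis
    unfolding radon_on_def scaled_law_def by (auto simp: sets_restrict_space)
qed

lemma nn_integral_scaled_law: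
  assumes "prob_space M" and X[measurable]: "X \<in> borel_measurable M" "Y \<in> borel_measurable M"
    and f: "f \<in> CK_plus punctured_quadrant"
  shows "(\<integral>\<^sup>+ p. ennreal (f p) \<partial>scaled_law M X Y a b t)
    = ennreal t * (\<integral>\<^sup>+ \<omega>. ennreal (extend_zero f (ennreal (X \<omega> / a t), ennreal (Y \<omega> / b t))) \<partial>M)"
proof -
  let ?h = "\<lambda>\<omega>. (ennreal (X \<omega> / a t), ennreal (Y \<omega> / b t))"
  have f0[measurable]: "extend_zero f \<in> borel_measurable borel"
    by (intro borel_measurable_continuous_onI extend_zero_CK_plus(1) f)
  have eq: "ennreal (f p) * indicator punctured_quadrant p = ennreal (extend_zero f p)" for p
    by (auto simp: extend_zero_def punctured_quadrant_def indicator_def)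
  let ?D = "distr M borel ?h"
  have "(\<lambda>p. ennreal (extend_zero f p)) \<in> borel_measurable (restrict_space ?D punctured_quadrant)"
    by (intro measurable_restrict_space1) measurable
  then have "(\<lambda>p. ennreal (f p)) \<in> borel_measurable (restrict_space ?D punctured_quadrant)"
    by (rule measurable_cong[THEN iffD1, rotated])
       (auto simp: space_restrict_space extend_zero_def punctured_quadrant_def)
  then have "(\<integral>\<^sup>+ p. ennreal (f p) \<partial>scaled_law M X Y a b t)
    = ennreal t * (\<integral>\<^sup>+ p. ennreal (f p) \<partial>restrict_space ?D punctured_quadrant)"
    unfolding scaled_law_def by (rule nn_integral_scale_measure)
  also have "(\<integral>\<^sup>+ p. ennreal (f p) \<partial>restrict_space ?D punctured_quadrant) = (\<integral>\<^sup>+ p. ennreal (extend_zero f p) \<partial>?D)"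
    using sets_punctured_quadrant by (subst nn_integral_restrict_space) (auto simp: eq)
  also have "\<dots> = (\<integral>\<^sup>+ \<omega>. ennreal (extend_zero f (?h \<omega>)) \<partial>M)"
    by (rule nn_integral_distr) measurable
  finally show ?thesis .
qed

lemma extend_zero_bounded:
  assumes "f \<in> CK_plus punctured_quadrant"
  shows "\<exists>B>0. \<forall>p. extend_zero f p \<le> B"
proof -
  have "compact (range (extend_zero f))"
    by (intro compact_continuous_image extend_zero_CK_plus(1) assms compact_UNIV_quadrant)
  then have "bounded (range (extend_zero f))" by (rule compact_imp_bounded)
  then obtain B where "B > 0" "\<And>p. norm (extend_zero f p) \<le> B"
    by (auto simp: bounded_pos)
  then show ?thesis by (intro exI[of _ B]) (auto simp: abs_le_iff)
qed

lemma nn_integral_scaled_law_real: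
  assumes "prob_space M" and X[measurable]: "X \<in> borel_measurable M" "Y \<in> borel_measurable M"
    and f: "f \<in> CK_plus punctured_quadrant" and t: "0 \<le> t"
  shows "integrable M (\<lambda>\<omega>. extend_zero f (ennreal (X \<omega> / a t), ennreal (Y \<omega> / b t)))"
    and "(\<integral>\<^sup>+ p. ennreal (f p) \<partial>scaled_law M X Y a b t)
    = ennreal (t * (\<integral> \<omega>. extend_zero f (ennreal (X \<omega> / a t), ennreal (Y \<omega> / b t)) \<partial>M))"
proof -
  interpret prob_space M by fact
  have f0[measurable]: "extend_zero f \<in> borel_measurable borel"
    by (intro borel_measurable_continuous_onI extend_zero_CK_plus(1) f)
  obtain B where "B > 0" "\<And>p. extend_zero f p \<le> B"
    using extend_zero_bounded[OF f] by blast
  then show int: "integrable M (\<lambda>\<omega>. extend_zero f (ennreal (X \<omega> / a t), ennreal (Y \<omega> / b t)))"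
    by (intro integrable_const_bound[of _ B]) (auto simp: extend_zero_CK_plus(3)[OF f])
  show "(\<integral>\<^sup>+ p. ennreal (f p) \<partial>scaled_law M X Y a b t)
    = ennreal (t * (\<integral> \<omega>. extend_zero f (ennreal (X \<omega> / a t), ennreal (Y \<omega> / b t)) \<partial>M))"
    unfolding nn_integral_scaled_law[OF assms(1-4)]
    using t by (subst nn_integral_eq_integral[OF int])
       (auto simp: extend_zero_CK_plus(3)[OF f] ennreal_mult integral_nonneg_AE)
qed

text \<open>
  The exceedance event is dominated by a multiple of a test function, whose scaled expectations
  converge to a finite limit.
\<close>
lemma exceedance_bounded:
  assumes "prob_space M" and [measurable]: "X \<in> borel_measurable M" "Y \<in> borel_measurable M"
    and conv: "vaguely_tendsto punctured_quadrant (scaled_law M X Y a b) \<nu> at_top"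
    and "c > 0"
  shows "\<exists>C>0. \<forall>\<^sub>F t in at_top. t * measure M {\<omega>\<in>space M. c \<le> X \<omega> / a t \<or> c \<le> Y \<omega> / b t} \<le> C"
proof -
  interpret prob_space M by fact
  let ?c = "c / 2"
  let ?f = "bump ?c"
  have c: "?c > 0" using \<open>c > 0\<close> by simp
  note bump = bump_in_CK_plus[OF c]
  let ?I = "\<lambda>t. (\<integral> \<omega>. extend_zero ?f (ennreal (X \<omega> / a t), ennreal (Y \<omega> / b t)) \<partial>M)"
  let ?J = "\<lambda>N. \<integral>\<^sup>+ p. ennreal (?f p) \<partial>N"
  have lim: "((\<lambda>t. ?J (scaled_law M X Y a b t)) \<longlongrightarrow> ?J \<nu>) at_top"
    and "radon_on punctured_quadrant \<nu>"
    using conv bump unfolding vaguely_tendsto_def by auto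
  then have "?J \<nu> < \<infinity>" using CK_plus_nn_integral_finite bump by blast
  then obtain L where L: "?J \<nu> = ennreal L" "L \<ge> 0" by (cases "?J \<nu>") auto
  have "\<forall>\<^sub>F t in at_top. ?J (scaled_law M X Y a b t) < ennreal (L + 1)"
    using lim by (rule order_tendstoD) (use L in \<open>auto simp: ennreal_less_iff\<close>)
  then have "\<forall>\<^sub>F t in at_top. t * measure M {\<omega>\<in>space M. c \<le> X \<omega> / a t \<or> c \<le> Y \<omega> / b t} \<le> (L + 1) / ?c"
    using eventually_ge_at_top[of 0]
  proof eventually_elim
    case (elim t)
    let ?A = "{\<omega>\<in>space M. c \<le> X \<omega> / a t \<or> c \<le> Y \<omega> / b t}"
    have tI: "t * ?I t < L + 1"
      using elim L nn_integral_scaled_law_real(2)[OF assms(1-3) bump elim(2)]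
      by (simp add: ennreal_less_iff integral_nonneg_AE extend_zero_CK_plus(3)[OF bump] del: ennreal_plus)
    have "?c * measure M ?A = (\<integral>\<omega>. ?c * indicator ?A \<omega> \<partial>M)" by (simp add: Int_absorb2)
    also have "\<dots> \<le> ?I t"
    proof (intro integral_mono nn_integral_scaled_law_real(1)[OF assms(1-3) bump elim(2)])
      fix \<omega> assume "\<omega> \<in> space M"
      let ?p = "(ennreal (X \<omega> / a t), ennreal (Y \<omega> / b t))"
      show "?c * indicator ?A \<omega> \<le> extend_zero ?f ?p"
      proof (cases "\<omega> \<in> ?A")
        case True
        then have *: "ennreal (2 * ?c) \<le> fst ?p \<or> ennreal (2 * ?c) \<le> snd ?p"
          by (auto intro: ennreal_leI)
        then have "?p \<noteq> (0, 0)" using c by auto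
        then have "extend_zero ?f ?p = ?f ?p" by (simp only: extend_zero_def if_False)
        then show ?thesis using bump_lower[OF c *] True by simp
      qed (use extend_zero_CK_plus(3)[OF bump] in auto)
    next
      show "integrable M (\<lambda>\<omega>. ?c * indicator ?A \<omega>)"
        by (intro integrable_mult_right integrable_real_indicator) (simp_all add: emeasure_eq_measure)
    qed
    finally have "t * (?c * measure M ?A) \<le> t * ?I t" using elim by (intro mult_left_mono) auto
    also have "\<dots> \<le> L + 1" using tI by simp
    finally show ?case using c by (simp add: field_simps)
  qed
  moreover have "(L + 1) / ?c > 0" using L c by simp
  ultimately show ?thesis by blast
qed

text \<open>
  If both pairs are relatively close, the test function changes by less than \<open>e / (2 C)\<close>, and this
  matters only on the exceedance event, where \<open>t P \<le> C\<close>. Every other way in which the test function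
  can change lies in one of four events: a relative deviation of one coordinate during an
  exceedance, or a jump of one coordinate from below \<open>d / 2\<close> to above \<open>d\<close>. Each of them has
  probability \<open>o(1 / t)\<close> by assumption, and the change is bounded.
\<close>
lemma vaguely_tendsto_perturb:
  assumes M: "prob_space M"
    and X[measurable]: "X \<in> borel_measurable M" and Y[measurable]: "Y \<in> borel_measurable M"
    and X'[measurable]: "X' \<in> borel_measurable M" and Y'[measurable]: "Y' \<in> borel_measurable M"
    and nonneg: "\<And>\<omega>. \<omega> \<in> space M \<Longrightarrow> 0 \<le> X \<omega> \<and> 0 \<le> Y \<omega> \<and> 0 \<le> X' \<omega> \<and> 0 \<le> Y' \<omega>"
    and pos: "\<forall>\<^sub>F t in at_top. 0 < a t" "\<forall>\<^sub>F t in at_top. 0 < b t"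
    and conv: "vaguely_tendsto punctured_quadrant (scaled_law M X Y a b) \<nu> at_top"
    and farX: "\<And>c h. 0 < c \<Longrightarrow> 0 < h \<Longrightarrow> ((\<lambda>t. t * measure M {\<omega>\<in>space M.
        (c \<le> X \<omega> / a t \<or> c \<le> Y \<omega> / b t) \<and> h * (1 + X \<omega> / a t) \<le> \<bar>X' \<omega> / a t - X \<omega> / a t\<bar>}) \<longlongrightarrow> 0) at_top"
    and farY: "\<And>c h. 0 < c \<Longrightarrow> 0 < h \<Longrightarrow> ((\<lambda>t. t * measure M {\<omega>\<in>space M.
        (c \<le> X \<omega> / a t \<or> c \<le> Y \<omega> / b t) \<and> h * (1 + Y \<omega> / b t) \<le> \<bar>Y' \<omega> / b t - Y \<omega> / b t\<bar>}) \<longlongrightarrow> 0) at_top"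
    and jumpX: "\<And>c. 0 < c \<Longrightarrow> ((\<lambda>t. t * measure M {\<omega>\<in>space M. X \<omega> / a t < c / 2 \<and> c \<le> X' \<omega> / a t}) \<longlongrightarrow> 0) at_top"
    and jumpY: "\<And>c. 0 < c \<Longrightarrow> ((\<lambda>t. t * measure M {\<omega>\<in>space M. Y \<omega> / b t < c / 2 \<and> c \<le> Y' \<omega> / b t}) \<longlongrightarrow> 0) at_top"
  shows "vaguely_tendsto punctured_quadrant (scaled_law M X' Y' a b) \<nu> at_top"
proof -
  interpret prob_space M by fact
  have nu: "radon_on punctured_quadrant \<nu>" using conv by (simp add: vaguely_tendsto_def)
  have "((\<lambda>t. \<integral>\<^sup>+ p. ennreal (f p) \<partial>scaled_law M X' Y' a b t) \<longlongrightarrow> (\<integral>\<^sup>+ p. ennreal (f p) \<partial>\<nu>)) at_top"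
    if f: "f \<in> CK_plus punctured_quadrant" for f
  proof -
    let ?g = "extend_zero f"
    define I where "I t = (\<integral> \<omega>. ?g (ennreal (X \<omega> / a t), ennreal (Y \<omega> / b t)) \<partial>M)" for t
    define I' where "I' t = (\<integral> \<omega>. ?g (ennreal (X' \<omega> / a t), ennreal (Y' \<omega> / b t)) \<partial>M)" for t
    have I0: "0 \<le> I t" "0 \<le> I' t" for t
      by (simp_all add: I_def I'_def integral_nonneg_AE extend_zero_CK_plus(3)[OF f])
    note int = nn_integral_scaled_law_real(1)[OF M X Y f]
    note int' = nn_integral_scaled_law_real(1)[OF M X' Y' f]
    have eqI: "\<forall>\<^sub>F t in at_top. (\<integral>\<^sup>+ p. ennreal (f p) \<partial>scaled_law M X Y a b t) = ennreal (t * I t)"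
      using eventually_ge_at_top[of 0]
      by eventually_elim (simp add: I_def nn_integral_scaled_law_real(2)[OF M X Y f])
    have eqI': "\<forall>\<^sub>F t in at_top. (\<integral>\<^sup>+ p. ennreal (f p) \<partial>scaled_law M X' Y' a b t) = ennreal (t * I' t)"
      using eventually_ge_at_top[of 0]
      by eventually_elim (simp add: I'_def nn_integral_scaled_law_real(2)[OF M X' Y' f])
    have "(\<integral>\<^sup>+ p. ennreal (f p) \<partial>\<nu>) < \<infinity>" using CK_plus_nn_integral_finite[OF nu f] .
    then obtain L where L: "(\<integral>\<^sup>+ p. ennreal (f p) \<partial>\<nu>) = ennreal L" "L \<ge> 0"
      by (cases "\<integral>\<^sup>+ p. ennreal (f p) \<partial>\<nu>") auto
    have "((\<lambda>t. \<integral>\<^sup>+ p. ennreal (f p) \<partial>scaled_law M X Y a b t) \<longlongrightarrow> ennreal L) at_top"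
      using conv f unfolding vaguely_tendsto_def L(1)[symmetric] by auto
    then have "((\<lambda>t. ennreal (t * I t)) \<longlongrightarrow> ennreal L) at_top"
      using eqI by (rule Lim_transform_eventually)
    moreover have "\<forall>\<^sub>F t in at_top. 0 \<le> t * I t"
      using eventually_ge_at_top[of 0] by eventually_elim (simp add: I0)
    ultimately have limI: "((\<lambda>t. t * I t) \<longlongrightarrow> L) at_top" using L(2) by simp
    obtain d where d: "d > 0" "\<And>x y. x < ennreal d \<Longrightarrow> y < ennreal d \<Longrightarrow> ?g (x, y) = 0"
      using extend_zero_CK_plus(2)[OF f] by blast
    obtain B where B: "B > 0" "\<And>p. ?g p \<le> B" using extend_zero_bounded[OF f] by blast
    have diffB: "\<bar>?g p - ?g q\<bar> \<le> B" for p q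
      using B(2)[of p] B(2)[of q] extend_zero_CK_plus(3)[OF f, of p] extend_zero_CK_plus(3)[OF f, of q] by linarith
    (* the gap between d / 2 and d separates small means from counts that f can see *)
    define c where "c = d / 2"
    have c: "c > 0" using d by (simp add: c_def)
    define A where "A t = {\<omega>\<in>space M. c \<le> X \<omega> / a t \<or> c \<le> Y \<omega> / b t}" for t
    have A[measurable]: "A t \<in> sets M" for t unfolding A_def by measurable
    obtain C where C: "C > 0" "\<forall>\<^sub>F t in at_top. t * measure M (A t) \<le> C"
      using exceedance_bounded[OF M X Y conv c] unfolding A_def by blast
    have "((\<lambda>t. t * I' t - t * I t) \<longlongrightarrow> 0) at_top"
    proof (rule tendstoI)
      fix e :: real assume "e > 0"
      (* half of e is for the exceedance event, where t P is at most C; half is for the rest *)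
      define e' where "e' = e / (2 * C)"
      have "e' > 0" using \<open>e > 0\<close> C by (simp add: e'_def)
      obtain h where h: "h > 0" "\<And>x y z w. 0 \<le> x \<Longrightarrow> 0 \<le> y \<Longrightarrow> 0 \<le> z \<Longrightarrow> 0 \<le> w \<Longrightarrow>
          \<bar>z - x\<bar> < h * (1 + x) \<Longrightarrow> \<bar>w - y\<bar> < h * (1 + y) \<Longrightarrow>
          \<bar>?g (ennreal z, ennreal w) - ?g (ennreal x, ennreal y)\<bar> < e'"
        using relative_uniform_continuity[OF extend_zero_CK_plus(1)[OF f] \<open>e' > 0\<close>] by metis
      define FX where "FX t = {\<omega>\<in>space M. (c \<le> X \<omega> / a t \<or> c \<le> Y \<omega> / b t) \<and> h * (1 + X \<omega> / a t) \<le> \<bar>X' \<omega> / a t - X \<omega> / a t\<bar>}" for t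
      define FY where "FY t = {\<omega>\<in>space M. (c \<le> X \<omega> / a t \<or> c \<le> Y \<omega> / b t) \<and> h * (1 + Y \<omega> / b t) \<le> \<bar>Y' \<omega> / b t - Y \<omega> / b t\<bar>}" for t
      define JX where "JX t = {\<omega>\<in>space M. X \<omega> / a t < d / 2 \<and> d \<le> X' \<omega> / a t}" for t
      define JY where "JY t = {\<omega>\<in>space M. Y \<omega> / b t < d / 2 \<and> d \<le> Y' \<omega> / b t}" for t
      have [measurable]: "FX t \<in> sets M" "FY t \<in> sets M" "JX t \<in> sets M" "JY t \<in> sets M" for t
        unfolding FX_def FY_def JX_def JY_def by measurable
      define R where "R t = measure M (FX t) + measure M (FY t) + measure M (JX t) + measure M (JY t)" for t
      have "((\<lambda>t. B * (t * measure M (FX t) + t * measure M (FY t) + t * measure M (JX t) + t * measure M (JY t)))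
          \<longlongrightarrow> B * (0 + 0 + 0 + 0)) at_top"
        unfolding FX_def FY_def JX_def JY_def
        by (intro tendsto_intros farX farY jumpX jumpY c h(1) d(1))
      then have "((\<lambda>t. B * (t * R t)) \<longlongrightarrow> 0) at_top"
        by (simp add: R_def distrib_left)
      then have "\<forall>\<^sub>F t in at_top. B * (t * R t) < e / 2"
        using \<open>e > 0\<close> by (intro order_tendstoD(2)) auto
      with C(2) pos eventually_ge_at_top[of 0]
      show "\<forall>\<^sub>F t in at_top. dist (t * I' t - t * I t) 0 < e"
      proof eventually_elim
        case (elim t)
        let ?D = "\<lambda>\<omega>. ?g (ennreal (X' \<omega> / a t), ennreal (Y' \<omega> / b t)) - ?g (ennreal (X \<omega> / a t), ennreal (Y \<omega> / b t))"
        let ?U = "\<lambda>\<omega>. e' * indicator (A t) \<omega>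
            + B * (indicator (FX t) \<omega> + indicator (FY t) \<omega> + indicator (JX t) \<omega> + indicator (JY t) \<omega>)"
        have intD: "integrable M ?D" by (intro Bochner_Integration.integrable_diff int int' elim)
        have ind: "integrable M (indicator S :: _ \<Rightarrow> real)" if "S \<in> sets M" for S
          using that by (intro integrable_real_indicator) (simp_all add: emeasure_eq_measure)
        have pw: "\<bar>?D \<omega>\<bar> \<le> ?U \<omega>" if \<omega>: "\<omega> \<in> space M" for \<omega>
        proof (cases "\<omega> \<in> FX t \<union> FY t \<union> JX t \<union> JY t")
          case True
          then have "1 \<le> indicator (FX t) \<omega> + indicator (FY t) \<omega> + indicator (JX t) \<omega> + (indicator (JY t) \<omega> :: real)"
            by (auto simp: indicator_def)
          then have "B * 1 \<le> B * (indicator (FX t) \<omega> + indicator (FY t) \<omega> + indicator (JX t) \<omega> + indicator (JY t) \<omega>)"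
            using B(1) by (intro mult_left_mono) auto
          moreover have "0 \<le> e' * indicator (A t) \<omega>" using \<open>e' > 0\<close> by simp
          ultimately show ?thesis using diffB[of "(ennreal (X' \<omega> / a t), ennreal (Y' \<omega> / b t))" "(ennreal (X \<omega> / a t), ennreal (Y \<omega> / b t))"] by linarith
        next
          case False
          have nn: "0 \<le> X \<omega> / a t" "0 \<le> Y \<omega> / b t" "0 \<le> X' \<omega> / a t" "0 \<le> Y' \<omega> / b t"
            using nonneg[OF \<omega>] elim by auto
          show ?thesis
          proof (cases "\<omega> \<in> A t")
            case True
            then have "\<bar>X' \<omega> / a t - X \<omega> / a t\<bar> < h * (1 + X \<omega> / a t)" "\<bar>Y' \<omega> / b t - Y \<omega> / b t\<bar> < h * (1 + Y \<omega> / b t)"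
              using False \<omega> by (auto simp: A_def FX_def FY_def not_le)
            then have "\<bar>?D \<omega>\<bar> < e'" using nn by (intro h(2)) auto
            then show ?thesis using True B(1) by (simp add: add_nonneg_nonneg add_increasing2)
          next
            case notA: False
            then have x: "X \<omega> / a t < c" "Y \<omega> / b t < c" using \<omega> by (auto simp: A_def not_le)
            then have "X' \<omega> / a t < d" "Y' \<omega> / b t < d"
              using False \<omega> by (auto simp: JX_def JY_def c_def)
            then have "?g (ennreal (X' \<omega> / a t), ennreal (Y' \<omega> / b t)) = 0"
              by (intro d(2) ennreal_lessI d(1))
            moreover have "X \<omega> / a t < d" "Y \<omega> / b t < d" using x d(1) unfolding c_def by linarith+
            then have "?g (ennreal (X \<omega> / a t), ennreal (Y \<omega> / b t)) = 0"
              by (intro d(2) ennreal_lessI d(1))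
            ultimately have "?D \<omega> = 0" by simp
            then show ?thesis using \<open>e' > 0\<close> B(1) by simp
          qed
        qed
        have "\<bar>I' t - I t\<bar> = \<bar>\<integral>\<omega>. ?D \<omega> \<partial>M\<bar>"
          unfolding I_def I'_def by (subst Bochner_Integration.integral_diff) (use int int' elim in auto)
        also have "\<dots> \<le> (\<integral>\<omega>. \<bar>?D \<omega>\<bar> \<partial>M)" by (rule integral_abs_bound)
        also have "\<dots> \<le> (\<integral>\<omega>. ?U \<omega> \<partial>M)"
          by (intro integral_mono pw integrable_abs intD Bochner_Integration.integrable_add
              integrable_mult_right ind) measurable
        also have "\<dots> = e' * measure M (A t) + B * R t"
          by (simp add: R_def ind Int_absorb2 sets.sets_into_space)
        finally have "t * \<bar>I' t - I t\<bar> \<le> t * (e' * measure M (A t) + B * R t)"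
          using elim by (intro mult_left_mono) auto
        also have "\<dots> = e' * (t * measure M (A t)) + B * (t * R t)" by (simp add: algebra_simps)
        also have "\<dots> \<le> e' * C + B * (t * R t)"
          using elim(1) \<open>e' > 0\<close> by (intro add_right_mono mult_left_mono) auto
        also have "e' * C = e / 2" using C(1) by (simp add: e'_def)
        finally have "t * \<bar>I' t - I t\<bar> < e" using elim by simp
        then show ?case using elim by (simp add: abs_mult flip: right_diff_distrib)
      qed
    qed
    then have "((\<lambda>t. (t * I' t - t * I t) + t * I t) \<longlongrightarrow> 0 + L) at_top"
      by (rule tendsto_add) (rule limI)
    then have "((\<lambda>t. t * I' t) \<longlongrightarrow> L) at_top" by simp
    then have "((\<lambda>t. ennreal (t * I' t)) \<longlongrightarrow> ennreal L) at_top" by (rule tendsto_ennrealI)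
    then show ?thesis
      unfolding L(1) by (rule Lim_transform_eventually) (use eqI' in eventually_elim, simp)
  qed
  then show ?thesis
    using nu radon_on_scaled_law[OF M X' Y'] unfolding vaguely_tendsto_def by auto
qed

section \<open>Poisson moments and deviations\<close>

lemma pmf_poisson_law:
  "0 \<le> r \<Longrightarrow> pmf (poisson_law r) k = r ^ k / fact k * exp (- r)"
  by (cases "r = 0") (auto simp: poisson_law_def power_0_left indicator_def)

lemma nn_integral_poisson_law:
  assumes "0 \<le> r"
  shows "(\<integral>\<^sup>+ k. g k \<partial>poisson_law r) = (\<Sum>k. ennreal (r ^ k / fact k * exp (- r)) * g k)"
  using assms by (simp add: nn_integral_measure_pmf nn_integral_count_space_nat pmf_poisson_law)

text \<open>
  The identity \<open>E [Z g(Z)] = r E [g(Z + 1)]\<close> for a Poisson variable \<open>Z\<close> of mean \<open>r\<close>: the weights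
  satisfy \<open>k w(k) = r w(k - 1)\<close>. It yields the first two moments.
\<close>
lemma poisson_law_shift:
  assumes "0 \<le> r"
  shows "(\<integral>\<^sup>+ k. of_nat k * g k \<partial>poisson_law r) = ennreal r * (\<integral>\<^sup>+ k. g (Suc k) \<partial>poisson_law r)"
proof -
  let ?w = "\<lambda>k. r ^ k / fact k * exp (- r)"
  let ?f = "\<lambda>k. ennreal (?w k) * (of_nat k * g k)"
  have step: "?f (Suc k) = ennreal r * (ennreal (?w k) * g (Suc k))" for k
  proof -
    have "r ^ Suc k / fact (Suc k) * real (Suc k) = r * (r ^ k / fact k)"
      by (simp add: fact_Suc[where 'a=real] field_simps del: of_nat_Suc fact_Suc)
    then have "?w (Suc k) * real (Suc k) = r * ?w k"
      by (metis mult.assoc mult.commute)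
    then have "ennreal (?w (Suc k)) * of_nat (Suc k) = ennreal r * ennreal (?w k)"
      using assms by (simp del: of_nat_Suc fact_Suc power_Suc add: ennreal_of_nat_eq_real_of_nat flip: ennreal_mult)
    then show ?thesis by (simp add: mult.assoc[symmetric] del: of_nat_Suc)
  qed
  have "(\<Sum>k. ?f k) = (\<Sum>k. ?f (Suc k))"
    using sums_unique[OF sums_Suc[of ?f "\<Sum>k. ?f (Suc k)"]] summable_sums[OF summableI, of "\<lambda>k. ?f (Suc k)"] by simp
  also have "\<dots> = ennreal r * (\<Sum>k. ennreal (?w k) * g (Suc k))"
    unfolding step by simp
  finally show ?thesis using assms by (simp add: nn_integral_poisson_law)
qed

lemma poisson_law_variance:
  assumes "0 \<le> r"
  shows "(\<integral>\<^sup>+ k. ennreal ((real k - r)\<^sup>2) \<partial>poisson_law r) = ennreal r"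
proof -
  have m1: "(\<integral>\<^sup>+ k. of_nat k \<partial>poisson_law r) = ennreal r"
    using poisson_law_shift[OF assms, of "\<lambda>_. 1"] by simp
  have "(\<integral>\<^sup>+ k. of_nat k * of_nat k \<partial>poisson_law r) = ennreal r * (ennreal r + 1)"
    unfolding poisson_law_shift[OF assms] using m1 by (simp add: nn_integral_add add.commute)
  also have "\<dots> = ennreal (r * (r + 1))" using assms by (simp add: ennreal_mult)
  finally have m2: "(\<integral>\<^sup>+ k. of_nat k * of_nat k \<partial>poisson_law r) = ennreal (r * (r + 1))" .
  let ?V = "\<integral>\<^sup>+ k. ennreal ((real k - r)\<^sup>2) \<partial>poisson_law r"
  have pt: "ennreal ((real k - r)\<^sup>2) + ennreal (2 * r) * of_nat k = of_nat k * of_nat k + ennreal (r\<^sup>2)" for k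
  proof -
    have "ennreal ((real k - r)\<^sup>2) + ennreal (2 * r * real k) = ennreal ((real k - r)\<^sup>2 + 2 * r * real k)"
      using assms by (intro ennreal_plus[symmetric]) auto
    also have "(real k - r)\<^sup>2 + 2 * r * real k = real k * real k + r\<^sup>2"
      by (simp add: power2_eq_square algebra_simps)
    also have "ennreal \<dots> = ennreal (real k * real k) + ennreal (r\<^sup>2)"
      by (intro ennreal_plus) auto
    finally show ?thesis
      using assms by (simp add: ennreal_of_nat_eq_real_of_nat ennreal_mult)
  qed
  have "?V + ennreal (2 * r) * (\<integral>\<^sup>+ k. of_nat k \<partial>poisson_law r)
     = (\<integral>\<^sup>+ k. ennreal ((real k - r)\<^sup>2) + ennreal (2 * r) * of_nat k \<partial>poisson_law r)"
    by (simp add: nn_integral_add nn_integral_cmult)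
  also have "\<dots> = (\<integral>\<^sup>+ k. of_nat k * of_nat k + ennreal (r\<^sup>2) \<partial>poisson_law r)"
    by (simp add: pt)
  also have "\<dots> = ennreal (r * (r + 1)) + ennreal (r\<^sup>2)"
    by (simp add: nn_integral_add m2)
  finally have "?V + ennreal (2 * r * r) = ennreal r + ennreal (2 * r * r)"
    using assms unfolding m1 by (simp add: power2_eq_square algebra_simps flip: ennreal_mult ennreal_plus)
  then show ?thesis by simp
qed

text \<open>
  Multiplying the weights of the Poisson law of mean \<open>r\<close> by \<open>2 ^ k\<close> gives \<open>exp r\<close> times those of mean
  \<open>2 r\<close>, which sum to one.
\<close>
lemma poisson_law_exp_moment:
  assumes "0 \<le> r"
  shows "(\<integral>\<^sup>+ k. ennreal (2 ^ k) \<partial>poisson_law r) = ennreal (exp r)"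
proof -
  have "ennreal (r ^ k / fact k * exp (- r)) * ennreal (2 ^ k)
     = ennreal (exp r) * (ennreal ((2 * r) ^ k / fact k * exp (- (2 * r))) * 1)" for k
  proof -
    have "exp (- r) = exp r * exp (- (2 * r))" by (simp flip: exp_add)
    then show ?thesis using assms by (simp add: power_mult_distrib flip: ennreal_mult)
  qed
  then have "(\<integral>\<^sup>+ k. ennreal (2 ^ k) \<partial>poisson_law r) = ennreal (exp r) * (\<integral>\<^sup>+ k. 1 \<partial>poisson_law (2 * r))"
    using assms by (simp only: nn_integral_poisson_law ennreal_suminf_cmult mult_nonneg_nonneg zero_le_numeral)
  then show ?thesis by simp
qed

lemma poisson_law_chebyshev:
  assumes "0 \<le> r" "0 < s"
  shows "emeasure (poisson_law r) {k. s \<le> \<bar>real k - r\<bar>} \<le> ennreal (r / s\<^sup>2)"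
proof -
  have "emeasure (poisson_law r) {k. s \<le> \<bar>real k - r\<bar>}
      = (\<integral>\<^sup>+ k. indicator {k. s \<le> \<bar>real k - r\<bar>} k \<partial>poisson_law r)" by simp
  also have "\<dots> \<le> (\<integral>\<^sup>+ k. ennreal (1 / s\<^sup>2) * ennreal ((real k - r)\<^sup>2) \<partial>poisson_law r)"
  proof (rule nn_integral_mono)
    fix k
    have "1 \<le> 1 / s\<^sup>2 * (real k - r)\<^sup>2" if "s \<le> \<bar>real k - r\<bar>"
    proof -
      have "s\<^sup>2 \<le> (real k - r)\<^sup>2" using that assms(2) by (simp flip: abs_le_square_iff)
      then show ?thesis using assms(2) by simp
    qed
    then show "indicator {k. s \<le> \<bar>real k - r\<bar>} k \<le> ennreal (1 / s\<^sup>2) * ennreal ((real k - r)\<^sup>2)"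
      by (auto simp: indicator_def simp flip: ennreal_mult ennreal_1 intro!: ennreal_leI)
  qed
  also have "\<dots> = ennreal (r / s\<^sup>2)"
    using assms by (subst nn_integral_cmult) (auto simp: poisson_law_variance simp flip: ennreal_mult)
  finally show ?thesis .
qed

text \<open>
  Markov's inequality for \<open>2 ^ Z\<close> gives the bound \<open>exp (r - s ln 2)\<close>, and \<open>ln 2 \<ge> 2 / 3\<close> exceeds
  \<open>1 / 2\<close>, with \<open>1 / 6\<close> to spare.
\<close>
lemma poisson_law_tail:
  assumes "0 \<le> r" "r \<le> s / 2"
  shows "emeasure (poisson_law r) {k. s \<le> real k} \<le> ennreal (exp (- (s / 6)))"
proof -
  have "emeasure (poisson_law r) {k. s \<le> real k} = (\<integral>\<^sup>+ k. indicator {k. s \<le> real k} k \<partial>poisson_law r)" by simp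
  also have "\<dots> \<le> (\<integral>\<^sup>+ k. ennreal (2 powr (- s)) * ennreal (2 ^ k) \<partial>poisson_law r)"
  proof (rule nn_integral_mono)
    fix k
    have "1 \<le> 2 powr (- s) * 2 ^ k" if "s \<le> real k"
    proof -
      have "2 powr (- s) * 2 ^ k = 2 powr (real k - s)"
        by (simp add: powr_realpow[symmetric] powr_diff powr_minus divide_inverse)
      then show ?thesis using that by (simp add: ge_one_powr_ge_zero)
    qed
    then show "indicator {k. s \<le> real k} k \<le> ennreal (2 powr (- s)) * ennreal (2 ^ k)"
      by (auto simp: indicator_def simp flip: ennreal_mult ennreal_1 intro!: ennreal_leI)
  qed
  also have "\<dots> = ennreal (2 powr (- s) * exp r)"
    using assms by (subst nn_integral_cmult) (auto simp: poisson_law_exp_moment simp flip: ennreal_mult)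
  also have "\<dots> \<le> ennreal (exp (- (s / 6)))"
  proof (rule ennreal_leI)
    have "2 / 3 * s \<le> ln 2 * s"
      using ln2_ge_two_thirds assms by (intro mult_right_mono) auto
    then have "r - s * ln 2 \<le> - (s / 6)" using assms by (simp add: mult.commute)
    moreover have "2 powr (- s) * exp r = exp (r - s * ln 2)"
      by (simp add: powr_def flip: exp_add)
    ultimately show "2 powr (- s) * exp r \<le> exp (- (s / 6))" by simp
  qed
  finally show ?thesis .
qed

section \<open>Conditionally Poisson counts\<close>

text \<open>
  Decompose according to the value \<open>k\<close> of \<open>Z\<close>. On each piece the condition on \<open>X\<close> is measurable with
  respect to \<open>X\<close>, so the indicator of \<open>Z = k\<close> may be replaced by its conditional probability.
\<close>
lemma emeasure_cond_poisson:
  fixes M :: "'w measure" and X :: "'w \<Rightarrow> 's::topological_space"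
  assumes "prob_space M" and X[measurable]: "X \<in> measurable M borel"
    and Z[measurable]: "Z \<in> measurable M (count_space UNIV)"
    and cp: "cond_poisson M X Z l"
    and l[measurable]: "l \<in> borel_measurable borel" and l0: "\<And>x. 0 \<le> l x"
    and Q[measurable]: "\<And>k. {x. Q x k} \<in> sets borel"
  shows "emeasure M {\<omega>\<in>space M. Q (X \<omega>) (Z \<omega>)}
    = (\<integral>\<^sup>+ \<omega>. emeasure (poisson_law (l (X \<omega>))) {k. Q (X \<omega>) k} \<partial>M)"
proof -
  interpret prob_space M by fact
  let ?G = "vimage_algebra (space M) X borel"
  have XG: "X \<in> measurable ?G borel" by (rule measurable_vimage_algebra1) auto
  have "subalgebra M ?G"
    unfolding subalgebra_def using sets_image_in_sets[OF refl X] by simp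
  then interpret finite_measure_subalgebra M ?G by unfold_locales
  let ?w = "\<lambda>k \<omega>. pmf (poisson_law (l (X \<omega>))) k"
  have [measurable]: "?w k \<in> borel_measurable M" for k
    by (simp add: pmf_poisson_law l0)
  have one: "emeasure M {\<omega>\<in>space M. Q (X \<omega>) k \<and> Z \<omega> = k}
      = (\<integral>\<^sup>+ \<omega>. ennreal (?w k \<omega>) * indicator {k. Q (X \<omega>) k} k \<partial>M)" for k
  proof -
    let ?u = "\<lambda>\<omega>. indicator {x. Q x k} (X \<omega>) :: real"
    let ?A = "{w \<in> space M. Z w = k}"
    have uG: "?u \<in> borel_measurable ?G"
      by (rule measurable_compose[OF XG]) measurable
    have uM[measurable]: "?u \<in> borel_measurable M"
      by (rule measurable_compose[OF X]) measurable
    have [measurable]: "?A \<in> sets M" by measurable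
    have [measurable]: "{\<omega>\<in>space M. Q (X \<omega>) k \<and> Z \<omega> = k} \<in> sets M"
    proof -
      have "{\<omega>\<in>space M. Q (X \<omega>) k \<and> Z \<omega> = k} = (X -` {x. Q x k} \<inter> space M) \<inter> ?A" by auto
      then show ?thesis using measurable_sets[OF X Q] by simp
    qed
    have "measure M {\<omega>\<in>space M. Q (X \<omega>) k \<and> Z \<omega> = k} = (\<integral>\<omega>. ?u \<omega> * indicator ?A \<omega> \<partial>M)"
    proof -
      have "measure M {\<omega>\<in>space M. Q (X \<omega>) k \<and> Z \<omega> = k}
          = (\<integral>\<omega>. indicator {\<omega>\<in>space M. Q (X \<omega>) k \<and> Z \<omega> = k} \<omega> \<partial>M)" by (simp add: Int_absorb2)
      also have "\<dots> = (\<integral>\<omega>. ?u \<omega> * indicator ?A \<omega> \<partial>M)"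
        by (intro Bochner_Integration.integral_cong) (auto simp: indicator_def)
      finally show ?thesis .
    qed
    also have "\<dots> = (\<integral>\<omega>. ?u \<omega> * cond_prob_given M X ?A \<omega> \<partial>M)"
      unfolding cond_prob_given_def
    proof (rule real_cond_exp_intg(2)[symmetric])
      show "integrable M (\<lambda>\<omega>. ?u \<omega> * indicator ?A \<omega>)"
        by (rule integrable_const_bound[of _ 1]) (simp add: indicator_def, measurable)
    qed (use uG in measurable)
    also have "\<dots> = (\<integral>\<omega>. ?u \<omega> * ?w k \<omega> \<partial>M)"
      using cp unfolding cond_poisson_def cond_prob_given_def
      by (intro integral_cong_AE) auto
    finally have "emeasure M {\<omega>\<in>space M. Q (X \<omega>) k \<and> Z \<omega> = k} = ennreal (\<integral>\<omega>. ?u \<omega> * ?w k \<omega> \<partial>M)"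
      by (simp add: emeasure_eq_measure)
    also have "\<dots> = (\<integral>\<^sup>+\<omega>. ennreal (?u \<omega> * ?w k \<omega>) \<partial>M)"
    proof (rule nn_integral_eq_integral[symmetric])
      show "integrable M (\<lambda>\<omega>. ?u \<omega> * ?w k \<omega>)"
        by (rule integrable_const_bound[of _ 1]) (simp add: indicator_def pmf_le_1, measurable)
    qed simp
    also have "\<dots> = (\<integral>\<^sup>+ \<omega>. ennreal (?w k \<omega>) * indicator {k. Q (X \<omega>) k} k \<partial>M)"
      by (intro nn_integral_cong) (auto simp: indicator_def)
    finally show ?thesis .
  qed
  have Qm[measurable]: "Measurable.pred M (\<lambda>\<omega>. Q (X \<omega>) k)" for k
    using measurable_sets[OF X Q[of k]] unfolding pred_def by (simp add: vimage_def Int_def conj_commute)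
  have "emeasure M {\<omega>\<in>space M. Q (X \<omega>) (Z \<omega>)} = emeasure M (\<Union>k. {\<omega>\<in>space M. Q (X \<omega>) k \<and> Z \<omega> = k})"
    by (rule arg_cong[where f="emeasure M"]) auto
  also have "\<dots> = (\<Sum>k. emeasure M {\<omega>\<in>space M. Q (X \<omega>) k \<and> Z \<omega> = k})"
    by (rule suminf_emeasure[symmetric]) (auto simp: disjoint_family_on_def)
  also have "\<dots> = (\<Sum>k. \<integral>\<^sup>+ \<omega>. ennreal (?w k \<omega>) * indicator {k. Q (X \<omega>) k} k \<partial>M)"
    by (simp only: one)
  also have "\<dots> = (\<integral>\<^sup>+ \<omega>. (\<Sum>k. ennreal (?w k \<omega>) * indicator {k. Q (X \<omega>) k} k) \<partial>M)"
  proof (rule nn_integral_suminf[symmetric])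
    fix k
    have "(\<lambda>\<omega>. ennreal (?w k \<omega>) * (if Q (X \<omega>) k then 1 else 0)) \<in> borel_measurable M" by measurable
    then show "(\<lambda>\<omega>. ennreal (?w k \<omega>) * indicator {k. Q (X \<omega>) k} k) \<in> borel_measurable M"
      by (simp add: indicator_def)
  qed
  also have "\<dots> = (\<integral>\<^sup>+ \<omega>. emeasure (poisson_law (l (X \<omega>))) {k. Q (X \<omega>) k} \<partial>M)"
    by (intro nn_integral_cong)
       (simp add: nn_integral_indicator[symmetric] nn_integral_measure_pmf nn_integral_count_space_nat del: nn_integral_indicator)
  finally show ?thesis .
qed

lemma emeasure_cond_poisson_le:
  fixes M :: "'w measure" and X :: "'w \<Rightarrow> 's::topological_space"
  assumes "prob_space M" and X[measurable]: "X \<in> measurable M borel"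
    and Z[measurable]: "Z \<in> measurable M (count_space UNIV)"
    and cp: "cond_poisson M X Z l"
    and l[measurable]: "l \<in> borel_measurable borel" and l0: "\<And>x. 0 \<le> l x"
    and A: "A \<in> sets borel"
    and Q: "\<And>k. {x. Q x k} \<in> sets borel"
    and le: "\<And>x. x \<in> A \<Longrightarrow> emeasure (poisson_law (l x)) {k. Q x k} \<le> c"
  shows "emeasure M {\<omega>\<in>space M. X \<omega> \<in> A \<and> Q (X \<omega>) (Z \<omega>)} \<le> c * emeasure M {\<omega>\<in>space M. X \<omega> \<in> A}"
proof -
  have "{x. x \<in> A \<and> Q x k} \<in> sets borel" for k
    using sets.Int[OF A Q[of k]] by (simp add: Int_def)
  then have "emeasure M {\<omega>\<in>space M. X \<omega> \<in> A \<and> Q (X \<omega>) (Z \<omega>)}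
     = (\<integral>\<^sup>+ \<omega>. emeasure (poisson_law (l (X \<omega>))) {k. X \<omega> \<in> A \<and> Q (X \<omega>) k} \<partial>M)"
    by (rule emeasure_cond_poisson[OF assms(1-6)])
  also have "\<dots> \<le> (\<integral>\<^sup>+ \<omega>. c * indicator {\<omega>\<in>space M. X \<omega> \<in> A} \<omega> \<partial>M)"
    using le by (intro nn_integral_mono) (auto simp: indicator_def)
  also have "\<dots> = c * emeasure M {\<omega>\<in>space M. X \<omega> \<in> A}"
    using measurable_sets[OF X A] by (intro nn_integral_cmult_indicator) (simp add: vimage_def Int_def conj_commute)
  finally show ?thesis .
qed

section \<open>Growth of regularly varying functions\<close>

text \<open>
  Doubling the argument eventually multiplies \<open>f\<close> by at least \<open>2 powr (\<gamma> / 2)\<close>, since the limiting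
  factor \<open>2 powr \<gamma>\<close> is larger. Iterating gives the bound along a dyadic sequence, and
  monotonicity fills the gaps at the cost of a constant.
\<close>
lemma regularly_varying_power_bound:
  assumes f: "f \<in> regularly_varying \<gamma>" and "\<gamma> > 0" and mono: "mono_on {0<..} f"
  shows "\<exists>C>0. \<exists>\<rho>>0. \<forall>\<^sub>F t in at_top. C * t powr \<rho> \<le> f t"
proof -
  (* any exponent strictly between 0 and \<gamma> would do *)
  define \<rho> where "\<rho> = \<gamma> / 2"
  obtain T where T: "T > 0" "\<And>t. t \<ge> T \<Longrightarrow> f t > 0"
    and lim: "\<And>c. c > 0 \<Longrightarrow> ((\<lambda>t. f (c * t) / f t) \<longlongrightarrow> c powr \<gamma>) at_top"
    using f unfolding regularly_varying_def by blast
  have "2 powr \<rho> < 2 powr \<gamma>" using \<open>\<gamma> > 0\<close> by (simp add: \<rho>_def)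
  then have "\<forall>\<^sub>F t in at_top. 2 powr \<rho> < f (2 * t) / f t"
    using order_tendstoD(1)[OF lim[of 2]] by simp
  then obtain S where S: "\<And>t. t \<ge> S \<Longrightarrow> 2 powr \<rho> < f (2 * t) / f t"
    unfolding eventually_at_top_linorder by blast
  define R where "R = max S T"
  have R: "R > 0" using T by (simp add: R_def)
  have pos: "f t > 0" if "t \<ge> R" for t using that T(2) by (simp add: R_def)
  have dbl: "2 powr \<rho> * f t \<le> f (2 * t)" if "t \<ge> R" for t
    using S[of t] that pos[OF that] by (simp add: R_def field_simps)
  have iter: "(2 ^ n) powr \<rho> * f R \<le> f (2 ^ n * R)" for n
  proof (induction n)
    case (Suc n)
    have "(2 ^ Suc n) powr \<rho> * f R = 2 powr \<rho> * ((2 ^ n) powr \<rho> * f R)"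
      by (simp add: powr_mult)
    also have "\<dots> \<le> 2 powr \<rho> * f (2 ^ n * R)" by (intro mult_left_mono Suc) simp
    also have "\<dots> \<le> f (2 * (2 ^ n * R))" using R by (intro dbl) simp
    finally show ?case by (simp add: mult.assoc)
  qed simp
  have bound: "f R * (1 / (2 * R)) powr \<rho> * t powr \<rho> \<le> f t" if t: "t \<ge> R" for t
  proof -
    have "t / R \<ge> 1" using t R by simp
    then obtain n where n: "2 ^ n \<le> t / R" "t / R < 2 ^ Suc n"
    proof -
      define m where "m = (LEAST m. t / R < 2 ^ m)"
      have m: "t / R < 2 ^ m"
        unfolding m_def by (rule LeastI_ex) (use real_arch_pow[of 2 "t / R"] in auto)
      then obtain n where "m = Suc n" using \<open>t / R \<ge> 1\<close> by (cases m) auto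
      moreover have "\<not> t / R < 2 ^ n"
        by (rule not_less_Least) (simp add: \<open>m = Suc n\<close> flip: m_def)
      ultimately show thesis using m that[of n] by auto
    qed
    have "f R * (1 / (2 * R)) powr \<rho> * t powr \<rho> = (t / R / 2) powr \<rho> * f R"
      using t R by (simp add: powr_mult[symmetric] mult.commute)
    also have "\<dots> \<le> (2 ^ n) powr \<rho> * f R"
      using n t R pos[of R] \<open>\<gamma> > 0\<close> by (intro mult_right_mono powr_mono2) (auto simp: \<rho>_def)
    also have "\<dots> \<le> f (2 ^ n * R)" by (rule iter)
    also have "\<dots> \<le> f t"
      using n R t by (intro mono_onD[OF mono]) (auto simp: field_simps)
    finally show ?thesis .
  qed
  show ?thesis
  proof (intro exI conjI)
    show "\<forall>\<^sub>F t in at_top. f R * (1 / (2 * R)) powr \<rho> * t powr \<rho> \<le> f t"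
      using eventually_ge_at_top[of R] by eventually_elim (rule bound)
  qed (use R pos[of R] \<open>\<gamma> > 0\<close> in \<open>auto simp: \<rho>_def\<close>)
qed

lemma regularly_varying_exp_decay:
  assumes f: "f \<in> regularly_varying \<gamma>" and "\<gamma> > 0" and mono: "mono_on {0<..} f" and "c > 0"
  shows "((\<lambda>t. t * exp (- (c * f t))) \<longlongrightarrow> 0) at_top"
proof -
  obtain C \<rho> where C: "C > 0" "\<rho> > 0" "\<forall>\<^sub>F t in at_top. C * t powr \<rho> \<le> f t"
    using regularly_varying_power_bound[OF assms(1-3)] by blast
  have "((\<lambda>t. t * exp (- (c * C * t powr \<rho>))) \<longlongrightarrow> 0) at_top"
  proof -
    define K where "K = c * C"
    have "K > 0" using C \<open>c > 0\<close> by (simp add: K_def)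
    then show ?thesis unfolding K_def[symmetric] using \<open>\<rho> > 0\<close> by real_asymp
  qed
  moreover have "\<forall>\<^sub>F t in at_top. norm (t * exp (- (c * f t))) \<le> t * exp (- (c * C * t powr \<rho>))"
    using C(3) eventually_ge_at_top[of 0]
  proof eventually_elim
    case (elim t)
    then have "c * (C * t powr \<rho>) \<le> c * f t" using \<open>c > 0\<close> by (intro mult_left_mono) auto
    then show ?case using elim by (auto intro!: mult_left_mono simp: abs_mult mult.assoc)
  qed
  ultimately show ?thesis by (rule Lim_null_comparison[rotated])
qed

section \<open>Counts against their means\<close>

text \<open>
  Given mean \<open>l\<close>, the deviation has size \<open>h (a t + l)\<close> before scaling. Chebyshev's inequality
  bounds its probability by \<open>l / (h (a t + l))\<^sup>2 \<le> 1 / (h\<^sup>2 a t)\<close>, which tends to zero uniformly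
  in \<open>l\<close>.
\<close>
lemma poisson_relative_deviation_negligible:
  fixes M :: "'w measure" and X :: "'w \<Rightarrow> 's::topological_space"
  assumes M: "prob_space M" and X[measurable]: "X \<in> measurable M borel"
    and Z[measurable]: "Z \<in> measurable M (count_space UNIV)"
    and cp: "cond_poisson M X Z l"
    and l[measurable]: "l \<in> borel_measurable borel" and l0: "\<And>x. 0 \<le> l x"
    and a: "filterlim a at_top at_top"
    and A: "\<And>t. A t \<in> sets borel"
    and C: "\<forall>\<^sub>F t in at_top. t * measure M {\<omega>\<in>space M. X \<omega> \<in> A t} \<le> C"
    and h: "0 < h"
  shows "((\<lambda>t. t * measure M {\<omega>\<in>space M. X \<omega> \<in> A t \<and>
      h * (1 + l (X \<omega>) / a t) \<le> \<bar>real (Z \<omega>) / a t - l (X \<omega>) / a t\<bar>}) \<longlongrightarrow> 0) at_top"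
proof (rule Lim_null_comparison)
  interpret prob_space M by fact
  let ?F = "\<lambda>t. {\<omega>\<in>space M. X \<omega> \<in> A t \<and>
      h * (1 + l (X \<omega>) / a t) \<le> \<bar>real (Z \<omega>) / a t - l (X \<omega>) / a t\<bar>}"
  have "\<forall>\<^sub>F t in at_top. 0 < a t" using a by (simp add: filterlim_at_top_dense)
  with C eventually_ge_at_top[of 0]
  show "\<forall>\<^sub>F t in at_top. norm (t * measure M (?F t)) \<le> C / h\<^sup>2 * inverse (a t)"
  proof eventually_elim
    case (elim t)
    have "emeasure M (?F t) \<le> ennreal (1 / (h\<^sup>2 * a t)) * emeasure M {\<omega>\<in>space M. X \<omega> \<in> A t}"
    proof (rule emeasure_cond_poisson_le[OF M X Z cp l l0 A, where
          Q = "\<lambda>x k. h * (1 + l x / a t) \<le> \<bar>real k / a t - l x / a t\<bar>"])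
      fix x
      let ?s = "h * (a t + l x)"
      have s: "?s > 0" using h elim l0[of x] by (intro mult_pos_pos) auto
      have "h * (1 + l x / a t) \<le> \<bar>real k / a t - l x / a t\<bar> \<longleftrightarrow> ?s \<le> \<bar>real k - l x\<bar>" for k
      proof -
        have "h * (1 + l x / a t) = ?s / a t" using elim by (simp add: field_simps)
        moreover have "\<bar>real k / a t - l x / a t\<bar> = \<bar>real k - l x\<bar> / a t"
          using elim by (simp flip: diff_divide_distrib)
        ultimately show ?thesis using elim by (simp add: divide_le_cancel)
      qed
      then have "emeasure (poisson_law (l x)) {k. h * (1 + l x / a t) \<le> \<bar>real k / a t - l x / a t\<bar>}
          \<le> ennreal (l x / ?s\<^sup>2)"
        using poisson_law_chebyshev[OF l0 s, of x] by simp
      also have "\<dots> \<le> ennreal (1 / (h\<^sup>2 * a t))"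
      proof (rule ennreal_leI)
        have "l x * a t \<le> (a t + l x)\<^sup>2"
          using elim l0[of x] by (simp add: power2_sum)
        then have "l x * (h\<^sup>2 * a t) \<le> ?s\<^sup>2"
          using h by (simp add: power_mult_distrib mult.left_commute)
        then show "l x / ?s\<^sup>2 \<le> 1 / (h\<^sup>2 * a t)"
          using zero_less_power[OF s, of 2] h elim
          by (subst pos_divide_le_eq) (simp_all add: pos_le_divide_eq)
      qed
      finally show "emeasure (poisson_law (l x)) {k. h * (1 + l x / a t) \<le> \<bar>real k / a t - l x / a t\<bar>}
          \<le> ennreal (1 / (h\<^sup>2 * a t))" .
    qed measurable
    then have le: "measure M (?F t) \<le> 1 / (h\<^sup>2 * a t) * measure M {\<omega>\<in>space M. X \<omega> \<in> A t}"
      using elim by (simp add: emeasure_eq_measure flip: ennreal_mult)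
    have "t * measure M (?F t) \<le> 1 / (h\<^sup>2 * a t) * (t * measure M {\<omega>\<in>space M. X \<omega> \<in> A t})"
      using mult_left_mono[OF le elim(2)] by (simp only: mult.left_commute)
    also have "\<dots> \<le> 1 / (h\<^sup>2 * a t) * C"
      using elim by (intro mult_left_mono) auto
    finally show ?case using elim by (simp add: field_simps)
  qed
  have "((\<lambda>t. inverse (a t)) \<longlongrightarrow> 0) at_top"
    by (rule tendsto_inverse_0_at_top[OF a])
  from tendsto_mult_right_zero[OF this]
  show "((\<lambda>t. C / h\<^sup>2 * inverse (a t)) \<longlongrightarrow> 0) at_top" .
qed

text \<open>
  The mean is at most \<open>c a t / 2\<close> while the count is at least \<open>c a t\<close>, so the exponential tail bound
  applies. A bound of fixed polynomial order in \<open>a t\<close> would absorb the factor \<open>t\<close> only for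
  large enough \<open>\<gamma>\<close>.
\<close>
lemma poisson_jump_negligible:
  fixes M :: "'w measure" and X :: "'w \<Rightarrow> 's::topological_space"
  assumes M: "prob_space M" and X[measurable]: "X \<in> measurable M borel"
    and Z[measurable]: "Z \<in> measurable M (count_space UNIV)"
    and cp: "cond_poisson M X Z l"
    and l[measurable]: "l \<in> borel_measurable borel" and l0: "\<And>x. 0 \<le> l x"
    and a: "filterlim a at_top at_top" "a \<in> regularly_varying \<gamma>" "\<gamma> > 0" "mono_on {0<..} a"
    and c: "0 < c"
  shows "((\<lambda>t. t * measure M {\<omega>\<in>space M. l (X \<omega>) / a t < c / 2 \<and> c \<le> real (Z \<omega>) / a t}) \<longlongrightarrow> 0) at_top"
proof (rule Lim_null_comparison)
  interpret prob_space M by fact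
  let ?F = "\<lambda>t. {\<omega>\<in>space M. l (X \<omega>) / a t < c / 2 \<and> c \<le> real (Z \<omega>) / a t}"
  have "\<forall>\<^sub>F t in at_top. 0 < a t" using a by (simp add: filterlim_at_top_dense)
  with eventually_ge_at_top[of 0]
  show "\<forall>\<^sub>F t in at_top. norm (t * measure M (?F t)) \<le> t * exp (- (c / 6 * a t))"
  proof eventually_elim
    case (elim t)
    let ?A = "{x. l x / a t < c / 2}"
    have "emeasure M {\<omega>\<in>space M. X \<omega> \<in> ?A \<and> c \<le> real (Z \<omega>) / a t}
        \<le> ennreal (exp (- (c / 6 * a t))) * emeasure M {\<omega>\<in>space M. X \<omega> \<in> ?A}"
    proof (rule emeasure_cond_poisson_le[OF M X Z cp l l0, where Q = "\<lambda>x k. c \<le> real k / a t"])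
      fix x assume "x \<in> ?A"
      then have "l x \<le> c * a t / 2" using elim by (simp add: field_simps)
      then show "emeasure (poisson_law (l x)) {k. c \<le> real k / a t} \<le> ennreal (exp (- (c / 6 * a t)))"
        using poisson_law_tail[OF l0, of x "c * a t"] elim by (simp add: pos_le_divide_eq)
    qed measurable
    also have "\<dots> \<le> ennreal (exp (- (c / 6 * a t))) * 1"
      by (intro mult_left_mono emeasure_le_1) auto
    finally have "measure M (?F t) \<le> exp (- (c / 6 * a t))"
      by (simp add: emeasure_eq_measure)
    then show ?case using elim by (simp add: abs_mult mult_left_mono)
  qed
  show "((\<lambda>t. t * exp (- (c / 6 * a t))) \<longlongrightarrow> 0) at_top"
    by (rule regularly_varying_exp_decay[OF a(2-4)]) (use c in auto)
qed

theorem theorem3p6: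
  fixes \<mu> :: "'s::metric_space measure"
    and \<kappa> :: "'s \<Rightarrow> 's \<Rightarrow> real"
    and M :: "'w measure"
    and X :: "'w \<Rightarrow> 's"
    and Zp Zm :: "'w \<Rightarrow> nat"
    and a b :: "real \<Rightarrow> real"
    and \<alpha> \<beta> :: real
    and \<nu> :: "(ennreal \<times> ennreal) measure"
  assumes "separable_space (euclidean :: 's topology)"
    and "prob_space \<mu>" and "sets \<mu> = sets borel"
    and "\<And>x y. 0 \<le> \<kappa> x y"
    and "case_prod \<kappa> \<in> borel_measurable (\<mu> \<Otimes>\<^sub>M \<mu>)"
    and "AE z in \<mu> \<Otimes>\<^sub>M \<mu>. isCont (case_prod \<kappa>) z"
    and "(\<integral>\<^sup>+ x. \<integral>\<^sup>+ y. ennreal (\<kappa> x y) \<partial>\<mu> \<partial>\<mu>) < \<infinity>"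
    and "prob_space M"
    and "X \<in> measurable M borel" and "distr M borel X = \<mu>"
    and "Zp \<in> measurable M (count_space UNIV)"
    and "Zm \<in> measurable M (count_space UNIV)"
    and "cond_indep M X Zp Zm"
    and "cond_poisson M X Zp (lambda_plus \<mu> \<kappa>)"
    and "cond_poisson M X Zm (lambda_minus \<mu> \<kappa>)"
    and "\<alpha> > 0" and "\<beta> > 0"
    and "a \<in> regularly_varying (1 / \<alpha>)" and "b \<in> regularly_varying (1 / \<beta>)"
    and "nonstandard_regularly_varying M
           (\<lambda>\<omega>. lambda_plus \<mu> \<kappa> (X \<omega>)) (\<lambda>\<omega>. lambda_minus \<mu> \<kappa> (X \<omega>)) a b \<nu>"
  shows "nonstandard_regularly_varying M (\<lambda>\<omega>. real (Zp \<omega>)) (\<lambda>\<omega>. real (Zm \<omega>)) a b \<nu>"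
proof -
  note M = \<open>prob_space M\<close> and X[measurable] = \<open>X \<in> measurable M borel\<close>
    and Zp[measurable] = \<open>Zp \<in> measurable M (count_space UNIV)\<close>
    and Zm[measurable] = \<open>Zm \<in> measurable M (count_space UNIV)\<close>
  note \<kappa> = \<open>case_prod \<kappa> \<in> borel_measurable (\<mu> \<Otimes>\<^sub>M \<mu>)\<close>
  interpret \<mu>: prob_space \<mu> by fact
  let ?p = "lambda_plus \<mu> \<kappa>" and ?m = "lambda_minus \<mu> \<kappa>"
  have borel_eq: "borel_measurable \<mu> = borel_measurable borel"
    by (rule measurable_cong_sets) (use assms(3) in auto)
  have m[measurable]: "?m \<in> borel_measurable borel"
    using \<mu>.borel_measurable_lebesgue_integral[of \<kappa> \<mu>] \<kappa>
    unfolding lambda_minus_def borel_eq by simp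
  have "(\<lambda>(x, y). \<kappa> y x) \<in> borel_measurable (\<mu> \<Otimes>\<^sub>M \<mu>)"
    using measurable_compose[OF measurable_pair_swap' \<kappa>] by (simp add: case_prod_beta)
  then have p[measurable]: "?p \<in> borel_measurable borel"
    using \<mu>.borel_measurable_lebesgue_integral[of "\<lambda>x y. \<kappa> y x" \<mu>]
    unfolding lambda_plus_def borel_eq by simp
  have p0: "0 \<le> ?p x" and m0: "0 \<le> ?m x" for x
    using assms(4) by (simp_all add: lambda_plus_def lambda_minus_def)
  have nrv: "scaling_function a" "scaling_function b" "emeasure \<nu> punctured_quadrant \<noteq> 0"
    and conv: "vaguely_tendsto punctured_quadrant (scaled_law M (\<lambda>\<omega>. ?p (X \<omega>)) (\<lambda>\<omega>. ?m (X \<omega>)) a b) \<nu> at_top"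
    using assms(20) unfolding nonstandard_regularly_varying_def by auto
  have a: "filterlim a at_top at_top" "mono_on {0<..} a" and b: "filterlim b at_top at_top" "mono_on {0<..} b"
    using nrv by (auto simp: scaling_function_def)
  have pX: "(\<lambda>\<omega>. ?p (X \<omega>)) \<in> borel_measurable M" and mX: "(\<lambda>\<omega>. ?m (X \<omega>)) \<in> borel_measurable M"
    and Zp': "(\<lambda>\<omega>. real (Zp \<omega>)) \<in> borel_measurable M" and Zm': "(\<lambda>\<omega>. real (Zm \<omega>)) \<in> borel_measurable M"
    by measurable
  define A where "A c t = {x. c \<le> ?p x / a t \<or> c \<le> ?m x / b t}" for c t
  have A: "A c t \<in> sets borel" for c t unfolding A_def by measurable
  have "vaguely_tendsto punctured_quadrant (scaled_law M (\<lambda>\<omega>. real (Zp \<omega>)) (\<lambda>\<omega>. real (Zm \<omega>)) a b) \<nu> at_top"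
  proof (rule vaguely_tendsto_perturb[OF M pX mX Zp' Zm' _ _ _ conv])
    fix c h :: real assume "0 < c" "0 < h"
    obtain C where C: "\<forall>\<^sub>F t in at_top. t * measure M {\<omega>\<in>space M. X \<omega> \<in> A c t} \<le> C"
      using exceedance_bounded[OF M pX mX conv \<open>0 < c\<close>] unfolding A_def by auto
    show "((\<lambda>t. t * measure M {\<omega>\<in>space M. (c \<le> ?p (X \<omega>) / a t \<or> c \<le> ?m (X \<omega>) / b t) \<and>
        h * (1 + ?p (X \<omega>) / a t) \<le> \<bar>real (Zp \<omega>) / a t - ?p (X \<omega>) / a t\<bar>}) \<longlongrightarrow> 0) at_top"
      using poisson_relative_deviation_negligible[OF M X Zp assms(14) p p0 a(1) A C \<open>0 < h\<close>]
      by (simp add: A_def)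
    show "((\<lambda>t. t * measure M {\<omega>\<in>space M. (c \<le> ?p (X \<omega>) / a t \<or> c \<le> ?m (X \<omega>) / b t) \<and>
        h * (1 + ?m (X \<omega>) / b t) \<le> \<bar>real (Zm \<omega>) / b t - ?m (X \<omega>) / b t\<bar>}) \<longlongrightarrow> 0) at_top"
      using poisson_relative_deviation_negligible[OF M X Zm assms(15) m m0 b(1) A C \<open>0 < h\<close>]
      by (simp add: A_def)
  next
    fix c :: real assume "0 < c"
    show "((\<lambda>t. t * measure M {\<omega>\<in>space M. ?p (X \<omega>) / a t < c / 2 \<and> c \<le> real (Zp \<omega>) / a t}) \<longlongrightarrow> 0) at_top"
      by (rule poisson_jump_negligible[OF M X Zp assms(14) p p0 a(1) assms(18) _ a(2) \<open>0 < c\<close>]) (use assms(16) in simp)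
    show "((\<lambda>t. t * measure M {\<omega>\<in>space M. ?m (X \<omega>) / b t < c / 2 \<and> c \<le> real (Zm \<omega>) / b t}) \<longlongrightarrow> 0) at_top"
      by (rule poisson_jump_negligible[OF M X Zm assms(15) m m0 b(1) assms(19) _ b(2) \<open>0 < c\<close>]) (use assms(17) in simp)
  qed (use a b p0 m0 in \<open>auto simp: filterlim_at_top_dense\<close>)
  then show ?thesis
    unfolding nonstandard_regularly_varying_def using nrv by auto
qed

end
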